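(* Let $a>0$, $\phi_a(x)=e^{-ax^2}$, and let $f=\sum_{k\in\mathbb{Z}}c_k\phi_a(\cdot-k)$ with $c\in\ell^\infty(\mathbb{Z})$, $f\not\equiv0$. Let $N_f$ be its set of real zeros, with multiplicities $m_f(x)$, $x\in N_f$. Then $D^-(N_f,m_f)\le1$.
   Context: The multiplicity $m_f(x)$ of a real zero $x$ is the order of vanishing of $f$ at $x$, i.e. the largest $m$ with $f^{(j)}(x)=0$ for $0\le j<m$. $D^-(N,m)=\liminf_{r\to\infty}\inf_{x\in\mathbb{R}}\frac{1}{2r}\sum_{\lambda\in N\cap[x-r,x+r]}m(\lambda)$. *)

theory Defs
  imports "HOL-Analysis.Analysis"
begin

definition gauss_sum :: "real \<Rightarrow> (int \<Rightarrow> complex) \<Rightarrow> real \<Rightarrow> complex" where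
  "gauss_sum a c x = infsum (\<lambda>k::int. c k * complex_of_real (exp (- a * (x - of_int k)^2))) UNIV"

definition higher_deriv_real :: "nat \<Rightarrow> (real \<Rightarrow> 'b::real_normed_vector) \<Rightarrow> real \<Rightarrow> 'b" where
  "higher_deriv_real j f = ((\<lambda>g x. vector_derivative g (at x)) ^^ j) f"

definition zero_mult :: "(real \<Rightarrow> 'b::real_normed_vector) \<Rightarrow> real \<Rightarrow> nat" where
  "zero_mult f x = (GREATEST m. \<forall>j<m. higher_deriv_real j f x = 0)"

definition lower_density :: "real set \<Rightarrow> (real \<Rightarrow> nat) \<Rightarrow> ereal" where
  "lower_density N m = Liminf at_top (\<lambda>r::real.
     ereal (INF x. (1 / (2 * r)) * (\<Sum>l\<in>N \<inter> {x - r..x + r}. real (m l))))"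

end

theory Submission
  imports Defs "HOL-Complex_Analysis.Complex_Analysis"
begin

text \<open>
  Writing \<open>w = exp (2 a x)\<close>, the function \<open>f\<close> equals \<open>exp (- a x\<^sup>2)\<close> times a Laurent series
  \<open>F w = (\<Sum>k. c\<^sub>k exp (- a k\<^sup>2) w\<^sup>k)\<close> which is holomorphic on the punctured plane and satisfies
  \<open>norm (F w) \<le> C exp (u\<^sup>2 / (4 a))\<close> for \<open>u = ln (norm w)\<close>. If the lower density exceeded 1, then for
  some \<open>l < n\<close> every closed window of some length below \<open>l\<close> would contain \<open>n\<close> zeros. Divide \<open>F\<close> by the
  product of \<open>1 - w / s\<close> over the chosen zeros \<open>s\<close> outside the unit circle and \<open>1 - s / w\<close> over those
  inside, taking \<open>J\<close> windows on each side. At \<open>w = 1\<close> this product is at most 1, whereas on the two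
  circles \<open>norm w = exp (\<plusminus> (2 a l J + 1))\<close> it is at least \<open>exp (a n l J\<^sup>2 - O(J))\<close>, while \<open>F\<close> is at most
  \<open>exp (a l\<^sup>2 J\<^sup>2 + O(J))\<close> there. By the maximum principle on the annulus, \<open>F 1 = 0\<close> in the limit
  \<open>J \<rightarrow> \<infinity>\<close>; but the origin can be placed at a point where \<open>f\<close> does not vanish.
\<close>

section \<open>A Jensen-type inequality on annuli\<close>

lemma maximum_modulus_annulus:
  fixes f :: "complex \<Rightarrow> complex"
  assumes hol: "f holomorphic_on - {0}" and "0 < r"
    and inner: "\<And>w. norm w = r \<Longrightarrow> norm (f w) \<le> B"
    and outer: "\<And>w. norm w = R \<Longrightarrow> norm (f w) \<le> B"
    and z: "r \<le> norm z" "norm z \<le> R"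
  shows "norm (f z) \<le> B"
proof -
  define S where "S = cball (0::complex) R - ball 0 r"
  have S_eq: "S = {w. r \<le> norm w \<and> norm w \<le> R}"
    by (auto simp: S_def)
  have "closed S"
    unfolding S_def by (intro closed_Diff) auto
  have "S \<subseteq> - {0}"
    using \<open>0 < r\<close> by (auto simp: S_eq)
  have "ball 0 R - cball 0 r \<subseteq> interior S"
    by (rule interior_maximal) (auto simp: S_eq)
  have fr: "frontier S \<subseteq> {w. norm w = r \<or> norm w = R}"
  proof -
    have "frontier S \<subseteq> S - (ball 0 R - cball 0 r)"
      using \<open>closed S\<close> \<open>ball 0 R - cball 0 r \<subseteq> interior S\<close> by (auto simp: frontier_def)
    thus ?thesis
      by (auto simp: S_eq)
  qed
  show ?thesis
  proof (rule maximum_modulus_frontier[of f S])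
    show "f holomorphic_on interior S"
      using hol \<open>S \<subseteq> - {0}\<close> interior_subset holomorphic_on_subset by blast
    show "continuous_on (closure S) f"
      using hol \<open>S \<subseteq> - {0}\<close> \<open>closed S\<close>
      by (metis closure_closed holomorphic_on_imp_continuous_on holomorphic_on_subset)
    show "bounded S"
      unfolding S_def by (rule bounded_subset[OF bounded_cball]) auto
  qed (use fr inner outer z in \<open>auto simp: S_eq\<close>)
qed

text \<open>This bound and the next serve the two circles used later: there every factor has modulus
  at least \<open>1 - exp (- t)\<close> or \<open>exp t - 1\<close> with
  \<open>t >= 1\<close>.\<close>

lemma half_le_one_minus_exp_neg:
  fixes t :: real
  assumes "t \<ge> 1"
  shows "1/2 \<le> 1 - exp (- t)"
proof -
  have "2 \<le> exp t"
    using exp_ge_add_one_self[of t] assms by linarith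
  thus ?thesis
    by (simp add: exp_minus field_simps)
qed

lemma exp_minus_one_ge:
  fixes t :: real
  assumes "t \<ge> 1"
  shows "exp (t - 1) \<le> exp t - 1"
proof -
  have "exp t = exp 1 * exp (t - 1)"
    by (simp flip: exp_add)
  moreover have "2 * exp (t - 1) \<le> exp 1 * exp (t - 1)"
    using exp_ge_add_one_self[of 1] by (intro mult_right_mono) auto
  moreover have "1 \<le> exp (t - 1)"
    using assms by simp
  ultimately show ?thesis
    by linarith
qed

section \<open>Normalised products over consecutive windows\<close>

lemma sum_descending: "(\<Sum>k<J. real J - 1 - real k) = real J * (real J - 1) / 2"
  by (induction J) (auto simp: sum.distrib sum_subtractf field_simps)

text \<open>The zeros are stored by their logarithms \<open>p k i\<close>, where \<open>k\<close>
  numbers the window. Evaluated at \<open>v = 1 / w\<close>, the same product handles the zeros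
  \<open>exp (- p k i)\<close> inside the unit circle.\<close>

definition lattice_prod :: "nat \<Rightarrow> nat \<Rightarrow> (nat \<Rightarrow> nat \<Rightarrow> real) \<Rightarrow> complex \<Rightarrow> complex" where
  "lattice_prod J n p v = (\<Prod>k<J. \<Prod>i<n. 1 - v / of_real (exp (p k i)))"

context
  fixes L :: real and n :: nat and p :: "nat \<Rightarrow> nat \<Rightarrow> real"
  assumes L: "L > 0"
    and p: "\<And>k i. i < n \<Longrightarrow> p k i \<in> {real k * L..(real k + 1) * L}"
begin

lemma norm_lattice_prod_outer:
  assumes v: "norm v = exp (real J * L + 1)"
  shows "norm (lattice_prod J n p v) \<ge> exp (real n * L * (real J * (real J - 1) / 2))"
proof -
  \<comment> \<open>The summand 1 in the radius \<open>exp (real J * L + 1)\<close> keeps the circle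
    at logarithmic distance at least 1 from every zero. It pays exactly for the loss in
    \<open>exp t - 1 >= exp (t - 1)\<close>.\<close>
  have factor: "exp ((real J - 1 - real k) * L) \<le> norm (1 - v / of_real (exp (p k i)))"
    if k: "k < J" and i: "i < n" for k i
  proof -
    define t where "t = real J * L + 1 - p k i"
    have t: "(real J - 1 - real k) * L \<le> t - 1"
      using p[OF i, of k] by (simp add: t_def algebra_simps)
    have "real k + 1 \<le> real J"
      using k by linarith
    hence "0 \<le> (real J - 1 - real k) * L"
      using L by simp
    hence "t \<ge> 1"
      using t by linarith
    have "exp ((real J - 1 - real k) * L) \<le> exp (t - 1)"
      using t by simp
    also have "\<dots> \<le> exp t - 1"
      by (rule exp_minus_one_ge) fact
    also have "exp t = norm (v / of_real (exp (p k i)))"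
      by (simp add: norm_divide v t_def exp_diff)
    also have "\<dots> - 1 \<le> norm (1 - v / of_real (exp (p k i)))"
      using norm_triangle_ineq2[of "v / of_real (exp (p k i))" 1]
      by (simp add: norm_minus_commute)
    finally show ?thesis .
  qed
  have "exp (real n * L * (real J * (real J - 1) / 2))
          = exp (\<Sum>k<J. \<Sum>i<n. (real J - 1 - real k) * L)"
    unfolding sum_descending[symmetric] sum_distrib_left
    by (simp add: mult_ac)
  also have "\<dots> = (\<Prod>k<J. \<Prod>i<n. exp ((real J - 1 - real k) * L))"
    by (simp only: exp_sum finite_lessThan)
  also have "\<dots> \<le> (\<Prod>k<J. \<Prod>i<n. norm (1 - v / of_real (exp (p k i))))"
    using factor by (intro prod_mono conjI prod_nonneg) auto
  also have "\<dots> = norm (lattice_prod J n p v)"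
    by (simp add: lattice_prod_def prod_norm)
  finally show ?thesis .
qed

text \<open>On the small circle \<open>v / s\<close> has modulus at most \<open>exp (- 1)\<close>.
  The crude factor 1/2 costs only \<open>n * J * ln 2\<close> after taking logarithms, which is
  negligible against the quadratic gain on the large circle.\<close>

lemma norm_lattice_prod_inner:
  assumes v: "norm v = exp (- (real J * L + 1))"
  shows "norm (lattice_prod J n p v) \<ge> (1/2) ^ (n * J)"
proof -
  have factor: "1/2 \<le> norm (1 - v / of_real (exp (p k i)))" if i: "i < n" for k i
  proof -
    have "0 \<le> real k * L"
      using L by simp
    hence "0 \<le> p k i"
      using p[OF i, of k] by simp
    hence "real J * L + 1 + p k i \<ge> 1"
      using L by simp
    hence "1/2 \<le> 1 - exp (- (real J * L + 1 + p k i))"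
      by (rule half_le_one_minus_exp_neg)
    also have "exp (- (real J * L + 1 + p k i)) = norm (v / of_real (exp (p k i)))"
      by (simp add: norm_divide v flip: exp_diff)
    also have "1 - \<dots> \<le> norm (1 - v / of_real (exp (p k i)))"
      using norm_triangle_ineq2[of 1 "v / of_real (exp (p k i))"] by simp
    finally show ?thesis .
  qed
  have "(1/2) ^ (n * J) = (\<Prod>k<J. \<Prod>i<n. 1/2 :: real)"
    by (simp add: power_mult)
  also have "\<dots> \<le> (\<Prod>k<J. \<Prod>i<n. norm (1 - v / of_real (exp (p k i))))"
    using factor by (intro prod_mono conjI prod_nonneg) auto
  also have "\<dots> = norm (lattice_prod J n p v)"
    by (simp add: lattice_prod_def prod_norm)
  finally show ?thesis .
qed

text \<open>All logarithms are nonnegative, so each factor at 1 is a real number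
  \<open>1 - exp (- p k i)\<close> in [0, 1).\<close>

lemma norm_lattice_prod_1: "norm (lattice_prod J n p 1) \<le> 1"
proof -
  have factor: "norm (1 - 1 / of_real (exp (p k i)) :: complex) \<le> 1" if i: "i < n" for k i
  proof -
    have "0 \<le> real k * L"
      using L by simp
    hence "exp (- p k i) \<le> 1"
      using p[OF i, of k] by simp
    moreover have "(1 - 1 / of_real (exp (p k i)) :: complex) = of_real (1 - exp (- p k i))"
      by (simp add: exp_minus field_simps)
    ultimately show ?thesis
      by (simp only: norm_of_real) simp
  qed
  have "norm (lattice_prod J n p 1) =
          (\<Prod>k<J. \<Prod>i<n. norm (1 - 1 / of_real (exp (p k i)) :: complex))"
    by (simp add: lattice_prod_def prod_norm)
  also have "\<dots> \<le> 1"
    using factor by (intro prod_le_1 conjI prod_nonneg) auto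
  finally show ?thesis .
qed

end

lemma quadratic_bounded_below_imp_nonneg:
  fixes d b e :: real
  assumes "\<And>J::nat. 0 \<le> d * real J ^ 2 + b * real J + e"
  shows "d \<ge> 0"
proof (rule ccontr)
  assume "\<not> d \<ge> 0"
  hence d: "- d > 0" by simp
  \<comment> \<open>For this \<open>J\<close> the linear part already beats the lower coefficients,
    and the quadratic takes a value at most -1.\<close>
  obtain J :: nat where J: "(\<bar>b\<bar> + \<bar>e\<bar> + 1) / (- d) < real J"
    using reals_Archimedean2 by blast
  hence 1: "\<bar>b\<bar> + \<bar>e\<bar> + 1 < - d * real J"
    using d by (simp add: field_simps)
  have "real J > 0"
    using J d by (smt (verit) divide_nonneg_pos abs_ge_zero)
  hence "1 \<le> real J" by simp
  have "(d * real J + b) * real J \<le> (- \<bar>e\<bar> - 1) * real J"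
    using 1 by (intro mult_right_mono) auto
  also have "\<dots> \<le> (- \<bar>e\<bar> - 1) * 1"
    using \<open>1 \<le> real J\<close> by (intro mult_left_mono_neg) auto
  finally show False
    using assms[of J] by (simp add: algebra_simps power2_eq_square)
qed

text \<open>With \<open>J\<close> windows on each side, log-growth of at most
  \<open>\<alpha> * L^2 * J^2\<close> up to O(J) must pay for a product of log-size
  \<open>n * L * J^2 / 2\<close> up to O(J), since \<open>F 1\<close> stays fixed and nonzero.
  Letting \<open>J\<close> grow compares the two leading coefficients.\<close>

lemma zero_count_le_growth:
  fixes F :: "complex \<Rightarrow> complex"
  assumes L: "L > 0"
    and growth: "\<And>w. w \<noteq> 0 \<Longrightarrow> norm (F w) \<le> exp (\<alpha> * (ln (norm w))^2 + B * \<bar>ln (norm w)\<bar> + C)"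
    and F1: "F 1 \<noteq> 0"
    and p: "\<And>k i. i < n \<Longrightarrow> p k i \<in> {real k * L..(real k + 1) * L}"
    and q: "\<And>k i. i < n \<Longrightarrow> q k i \<in> {real k * L..(real k + 1) * L}"
    and zeros: "\<And>J. \<exists>H. H holomorphic_on - {0} \<and> (\<forall>w. w \<noteq> 0 \<longrightarrow>
      F w = H w * (\<Prod>k<J. \<Prod>i<n. (w - of_real (exp (p k i))) * (w - of_real (exp (- q k i)))))"
  shows "real n \<le> 2 * \<alpha> * L"
proof -
  have bound: "norm (F 1) \<le> exp (\<alpha> * (real J * L + 1)^2 + B * (real J * L + 1) + C)
      / (exp (real n * L * (real J * (real J - 1) / 2)) * (1/2) ^ (n * J))" (is "_ \<le> ?M / ?D") for J
  proof -
    define U where "U = real J * L + 1"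
    have U: "U \<ge> 1"
      using L by (simp add: U_def)
    obtain H where H: "H holomorphic_on - {0}" and F_eq: "\<And>w. w \<noteq> 0 \<Longrightarrow>
        F w = H w * (\<Prod>k<J. \<Prod>i<n. (w - of_real (exp (p k i))) * (w - of_real (exp (- q k i))))"
      using zeros[of J] by blast
    \<comment> \<open>The extra factors turn each \<open>w - s\<close> into \<open>1 - w / s\<close>
      for the outer zeros and \<open>1 - s / w\<close> for the inner ones. Hence \<open>K\<close> is
      the quotient of \<open>F\<close> by the normalised products, extended holomorphically across
      the zeros.\<close>
    define K where "K w = H w * (\<Prod>k<J. \<Prod>i<n. - of_real (exp (p k i)) * w)" for w
    have K: "K holomorphic_on - {0}"
      unfolding K_def using H by (auto intro!: holomorphic_intros)
    have FK: "F w = K w * (lattice_prod J n p w * lattice_prod J n q (1 / w))" if "w \<noteq> 0" for w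
    proof -
      have "(w - of_real (exp (p k i))) * (w - of_real (exp (- q k i))) =
          (- of_real (exp (p k i)) * w) * ((1 - w / of_real (exp (p k i))) * (1 - 1 / w / of_real (exp (q k i))))"
        for k i
        using that by (simp add: field_simps exp_minus)
      thus ?thesis
        unfolding F_eq[OF that] K_def lattice_prod_def by (simp only: prod.distrib mult.assoc)
    qed
    have D: "?D > 0" by simp
    have quotient_bound: "norm (K w) \<le> ?M / ?D"
      if w: "w \<noteq> 0" and u: "\<bar>ln (norm w)\<bar> = U"
        and P: "?D \<le> norm (lattice_prod J n p w * lattice_prod J n q (1 / w))" for w
    proof -
      have "norm (K w) * ?D \<le> norm (K w) * norm (lattice_prod J n p w * lattice_prod J n q (1 / w))"
        using P by (intro mult_left_mono) auto
      also have "\<dots> = norm (F w)"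
        using FK[OF w] by (simp add: norm_mult)
      also have "\<dots> \<le> exp (\<alpha> * \<bar>ln (norm w)\<bar>^2 + B * \<bar>ln (norm w)\<bar> + C)"
        using growth[OF w] by simp
      also have "\<dots> = ?M"
        unfolding u U_def ..
      finally show ?thesis
        using D by (simp add: pos_le_divide_eq)
    qed
    have "norm (F 1) = norm (K 1) * (norm (lattice_prod J n p 1) * norm (lattice_prod J n q 1))"
      using FK[of 1] by (simp add: norm_mult)
    also have "\<dots> \<le> norm (K 1) * (1 * 1)"
      using norm_lattice_prod_1[of L n p J, OF L p] norm_lattice_prod_1[of L n q J, OF L q]
      by (intro mult_left_mono mult_mono) auto
    also have "\<dots> \<le> ?M / ?D"
    proof (simp only: mult_1_right, rule maximum_modulus_annulus[OF K])
      show "0 < exp (- U)" "exp (- U) \<le> norm (1::complex)" "norm (1::complex) \<le> exp U"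
        using U by auto
    next
      \<comment> \<open>Here the product over \<open>p\<close> is the large one and the product over
        \<open>q\<close>, taken at \<open>1 / w\<close>, is merely bounded below. On the inner
        circle the roles are exchanged, so both circles give the same \<open>?D\<close>.\<close>
      fix w :: complex assume w: "norm w = exp U"
      hence "norm (1 / w) = exp (- U)"
        by (simp add: norm_divide exp_minus field_simps)
      hence "?D \<le> norm (lattice_prod J n p w * lattice_prod J n q (1 / w))"
        using w norm_lattice_prod_outer[of L n p, OF L p, of w J]
          norm_lattice_prod_inner[of L n q, OF L q, of "1 / w" J]
        unfolding norm_mult U_def by (intro mult_mono) auto
      thus "norm (K w) \<le> ?M / ?D"
        using w U by (intro quotient_bound) auto
    next
      fix w :: complex assume w: "norm w = exp (- U)"
      hence "norm (1 / w) = exp U"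
        by (simp add: norm_divide exp_minus inverse_eq_divide)
      hence "?D \<le> norm (lattice_prod J n q (1 / w) * lattice_prod J n p w)"
        using w norm_lattice_prod_outer[of L n q, OF L q, of "1 / w" J]
          norm_lattice_prod_inner[of L n p, OF L p, of w J]
        unfolding norm_mult U_def by (intro mult_mono) auto
      thus "norm (K w) \<le> ?M / ?D"
        using w U by (intro quotient_bound) (auto simp: mult.commute)
    qed
    finally show ?thesis .
  qed
  \<comment> \<open>The logarithm of \<open>bound\<close>, sorted by powers of \<open>J\<close>;
    \<open>B\<close>, \<open>C\<close> and \<open>norm (F 1)\<close> do not enter the leading
    coefficient.\<close>
  have "0 \<le> (\<alpha> * L^2 - real n * L / 2) * real J ^ 2
          + (2 * \<alpha> * L + B * L + real n * ln 2 + real n * L / 2) * real J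
          + (\<alpha> + B + C - ln (norm (F 1)))" for J :: nat
  proof -
    have "ln (norm (F 1)) \<le> ln (exp (\<alpha> * (real J * L + 1)^2 + B * (real J * L + 1) + C)
      / (exp (real n * L * (real J * (real J - 1) / 2)) * (1/2) ^ (n * J)))"
      using bound[of J] F1 by (subst ln_le_cancel_iff) auto
    also have "\<dots> = \<alpha> * (real J * L + 1)^2 + B * (real J * L + 1) + C
       - real n * L * (real J * (real J - 1) / 2) + real n * real J * ln 2"
      by (simp add: ln_div ln_mult ln_realpow)
    finally show ?thesis
      by (simp add: algebra_simps power2_eq_square diff_divide_distrib)
  qed
  hence "0 \<le> \<alpha> * L^2 - real n * L / 2"
    by (rule quadratic_bounded_below_imp_nonneg)
  hence "real n * L \<le> (2 * \<alpha> * L) * L"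
    by (simp add: power2_eq_square)
  thus ?thesis
    using L by (simp only: mult_le_cancel_right)
qed

section \<open>Factoring out zeros with multiplicity\<close>

lemma eventually_nonzero_at:
  fixes f :: "complex \<Rightarrow> complex"
  assumes "f holomorphic_on A" "open A" "connected A" "z \<in> A" "\<exists>w\<in>A. f w \<noteq> 0"
  shows "eventually (\<lambda>w. f w \<noteq> 0) (at z)"
proof -
  obtain w0 where "w0 \<in> A" "f w0 \<noteq> 0"
    using assms(5) by blast
  hence "eventually (\<lambda>w. f w \<noteq> 0 \<and> w \<in> A) (at z)"
    using assms by (intro non_zero_neighbour_alt) auto
  thus ?thesis
    by eventually_elim auto
qed

text \<open>Zeros are removed one index at a time: dividing by \<open>w - s\<close> lowers the order
  at \<open>s\<close> by one and leaves all other orders alone. Multiplicity is encoded by repeated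
  values of the family \<open>z\<close>, so the condition bounds the size of its fibres.\<close>

lemma holomorphic_factor_zeros:
  fixes f :: "complex \<Rightarrow> complex" and z :: "'i \<Rightarrow> complex"
  assumes "finite I" and A: "open A" "connected A"
    and "f holomorphic_on A" "\<exists>w\<in>A. f w \<noteq> 0"
    and "\<And>i. i \<in> I \<Longrightarrow> z i \<in> A"
    and "\<And>s. s \<in> A \<Longrightarrow> int (card {i\<in>I. z i = s}) \<le> zorder f s"
  shows "\<exists>h. h holomorphic_on A \<and> (\<forall>w\<in>A. f w = h w * (\<Prod>i\<in>I. w - z i))"
  using assms(1,4-)
proof (induction I arbitrary: f rule: finite_induct)
  case empty
  thus ?case
    by (intro exI[of _ f]) auto
next
  case (insert j I)
  define s where "s = z j"
  \<comment> \<open>Since \<open>f s = 0\<close> is shown below, this difference quotient is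
    \<open>f w / (w - s)\<close> with the removable singularity at \<open>s\<close> filled
    in.\<close>
  define g where "g w = (if w = s then deriv f s else (f w - f s) / (w - s))" for w
  have s: "s \<in> A"
    using insert.prems by (auto simp: s_def)
  have card_insert: "card {i \<in> insert j I. z i = t} = card {i\<in>I. z i = t} + of_bool (t = s)" for t
  proof (cases "t = s")
    case True
    have "{i \<in> insert j I. z i = t} = insert j {i\<in>I. z i = t}"
      using True by (auto simp: s_def)
    thus ?thesis
      using True insert.hyps by simp
  next
    case False
    hence "{i \<in> insert j I. z i = t} = {i\<in>I. z i = t}"
      by (auto simp: s_def)
    thus ?thesis
      using False by simp
  qed
  \<comment> \<open>The new index \<open>j\<close> lies in the fibre over \<open>s\<close>, so the
    hypothesis forces order at least 1.\<close>
  have "zorder f s > 0"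
    using insert.prems(4)[OF s] unfolding card_insert by simp
  have "f s = 0"
    using zorder_exist_zero[OF insert.prems(1) A s insert.prems(2)] \<open>zorder f s > 0\<close>
    by (auto split: if_splits)
  have g: "g holomorphic_on A"
    unfolding g_def using pole_lemma[OF insert.prems(1), of s] s A by (simp add: interior_open)
  have fg: "f w = (w - s) * g w" for w
    using \<open>f s = 0\<close> by (simp add: g_def)
  have g_nz: "\<exists>w\<in>A. g w \<noteq> 0"
    using insert.prems(2) fg by auto
  have zorder_fg: "zorder f t = of_bool (t = s) + zorder g t" if t: "t \<in> A" for t
  proof -
    have "zorder f t = zorder (\<lambda>w. (w - s) * g w) t"
      by (simp add: fg[abs_def])
    also have "\<dots> = zorder (\<lambda>w. w - s) t + zorder g t"
    proof (rule zorder_times_analytic)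
      show "g analytic_on {t}"
        using g A t analytic_at by blast
      show "eventually (\<lambda>w. (w - s) * g w \<noteq> 0) (at t)"
        using eventually_nonzero_at[OF insert.prems(1) A t insert.prems(2)] by (simp add: fg)
    qed (auto intro!: analytic_intros)
    also have "zorder (\<lambda>w. w - s) t = of_bool (t = s)"
    proof (cases "t = s")
      case True
      show ?thesis
        unfolding True by (rule zorder_eqI[of UNIV _ "\<lambda>_. 1"]) auto
    next
      case False
      thus ?thesis
        by (subst zorder_eq_0I) (auto intro!: analytic_intros)
    qed
    finally show ?thesis .
  qed
  have "\<exists>h. h holomorphic_on A \<and> (\<forall>w\<in>A. g w = h w * (\<Prod>i\<in>I. w - z i))"
  proof (rule insert.IH[OF g g_nz])
    fix t assume t: "t \<in> A"
    show "int (card {i\<in>I. z i = t}) \<le> zorder g t"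
      using insert.prems(4)[OF t] zorder_fg[OF t] unfolding card_insert by simp
  qed (use insert.prems in auto)
  then obtain h where "h holomorphic_on A" "\<And>w. w \<in> A \<Longrightarrow> g w = h w * (\<Prod>i\<in>I. w - z i)"
    by blast
  thus ?case
    using insert.hyps by (intro exI[of _ h]) (auto simp: fg s_def)
qed

text \<open>A greedy choice works: if every point of \<open>A\<close> were already used to its full
  multiplicity, the total would be at most the number of indices spent so far.\<close>

lemma select_with_multiplicity:
  fixes m :: "'a \<Rightarrow> nat"
  assumes "n \<le> (\<Sum>s\<in>A. m s)"
  shows "\<exists>z :: nat \<Rightarrow> 'a. (\<forall>i<n. z i \<in> A) \<and> (\<forall>s. card {i. i < n \<and> z i = s} \<le> m s)"
  using assms
proof (induction n)
  case 0
  show ?case by simp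
next
  case (Suc n)
  then obtain z :: "nat \<Rightarrow> 'a" where z: "\<forall>i<n. z i \<in> A" "\<forall>s. card {i. i < n \<and> z i = s} \<le> m s"
    by auto
  \<comment> \<open>A sum over an infinite set is 0 by convention, which contradicts the positive
    lower bound.\<close>
  have "finite A"
    using Suc.prems by (cases "finite A") auto
  have "\<exists>s\<in>A. card {i. i < n \<and> z i = s} < m s"
  proof (rule ccontr)
    assume "\<not> ?thesis"
    hence "(\<Sum>s\<in>A. m s) \<le> (\<Sum>s\<in>A. card {i. i < n \<and> z i = s})"
      by (intro sum_mono) auto
    also have "\<dots> = card (\<Union>s\<in>A. {i. i < n \<and> z i = s})"
      using \<open>finite A\<close> by (subst card_UN_disjoint) auto
    also have "\<dots> \<le> card {..<n}"
      by (intro card_mono) auto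
    finally show False
      using Suc.prems by simp
  qed
  then obtain s where s: "s \<in> A" "card {i. i < n \<and> z i = s} < m s"
    by blast
  have "card {i. i < Suc n \<and> (z(n := s)) i = t} \<le> m t" for t
  proof (cases "t = s")
    case True
    have "{i. i < Suc n \<and> (z(n := s)) i = t} = insert n {i. i < n \<and> z i = s}"
      using True by (auto simp: less_Suc_eq)
    thus ?thesis
      using s(2) True by simp
  next
    case False
    hence "{i. i < Suc n \<and> (z(n := s)) i = t} = {i. i < n \<and> z i = t}"
      by (auto simp: less_Suc_eq)
    thus ?thesis
      using z(2) by simp
  qed
  thus ?case
    using z(1) s(1) by (intro exI[of _ "z(n := s)"]) (auto simp: less_Suc_eq)
qed

section \<open>Real multiplicity as the order of a holomorphic extension\<close>

lemma higher_deriv_real_holomorphic: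
  assumes "g holomorphic_on UNIV"
  shows "higher_deriv_real j (\<lambda>x. g (of_real x)) = (\<lambda>x. (deriv ^^ j) g (of_real x))"
proof (induction j)
  case 0
  show ?case
    by (simp add: higher_deriv_real_def)
next
  case (Suc j)
  have "(deriv ^^ j) g holomorphic_on UNIV"
    using assms by (intro holomorphic_higher_deriv) auto
  hence "((deriv ^^ j) g has_field_derivative deriv ((deriv ^^ j) g) (of_real x)) (at (of_real x))" for x
    using holomorphic_derivI by blast
  hence "((\<lambda>x. (deriv ^^ j) g (of_real x)) has_vector_derivative
          deriv ((deriv ^^ j) g) (of_real x)) (at x)" for x
    by (rule has_vector_derivative_real_field)
  hence "vector_derivative (\<lambda>x. (deriv ^^ j) g (of_real x)) (at x) =
          deriv ((deriv ^^ j) g) (of_real x)" for x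
    by (rule vector_derivative_at)
  thus ?case
    using Suc.IH by (simp add: higher_deriv_real_def)
qed

text \<open>By the identity theorem some derivative at the point is nonzero. The least such index is
  the order, and it also bounds the set under \<open>GREATEST\<close>, so that the latter is
  attained.\<close>

lemma zero_mult_eq_zorder:
  assumes hol: "g holomorphic_on UNIV" and nz: "g z0 \<noteq> 0"
  shows "int (zero_mult (\<lambda>x. g (of_real x)) x) = zorder g (of_real x)"
proof -
  have "\<exists>n. (deriv ^^ n) g (of_real x) \<noteq> 0"
    using holomorphic_fun_eq_0_on_connected[OF hol, of "of_real x" z0] nz by auto
  then obtain n where n: "(deriv ^^ n) g (of_real x) \<noteq> 0"
      and less: "\<And>j. j < n \<Longrightarrow> (deriv ^^ j) g (of_real x) = 0"
    using exists_least_iff[of "\<lambda>n. (deriv ^^ n) g (of_real x) \<noteq> 0"] by blast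
  have "zorder g (of_real x) = int n"
    using n less hol by (intro zorder_zero_eqI[of g UNIV]) auto
  moreover have "zero_mult (\<lambda>x. g (of_real x)) x = n"
    unfolding zero_mult_def higher_deriv_real_holomorphic[OF hol]
    using n less by (intro Greatest_equality) (auto simp: not_less[symmetric])
  ultimately show ?thesis by simp
qed

text \<open>Pairs window \<open>k\<close> on the right of the origin with its mirror image, window
  \<open>- 1 - k\<close>, on the left.\<close>

lemma prod_symmetric_int:
  fixes g :: "int \<Rightarrow> 'a :: comm_monoid_mult"
  shows "(\<Prod>j\<in>{- int J..<int J}. g j) = (\<Prod>k<J. g (int k) * g (- 1 - int k))"
proof (induction J)
  case (Suc J)
  have "{- int (Suc J)..<int (Suc J)} = insert (int J) (insert (- 1 - int J) {- int J..<int J})"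
    by auto
  thus ?case
    using Suc.IH by (simp add: mult_ac)
qed simp

section \<open>The Laurent series of a Gaussian sum\<close>

lemma summable_on_int_gaussian:
  fixes b :: real
  assumes "b > 0"
  shows "(\<lambda>j::int. exp (- b * (of_int j)^2)) summable_on UNIV"
proof -
  have nat_sum: "(\<lambda>n::nat. exp (- b * (of_nat n)^2)) summable_on UNIV"
  proof (rule summable_on_comparison_test)
    have "summable (\<lambda>n. exp (- b) ^ n)"
      using assms by (intro summable_geometric) auto
    thus "(\<lambda>n. exp (- b) ^ n) summable_on UNIV"
      by (rule summable_nonneg_imp_summable_on) auto
    fix n :: nat
    have "real n \<le> real n ^ 2"
      by (cases n) (auto simp: power2_eq_square)
    hence "- b * real n ^ 2 \<le> - b * real n"
      using assms by simp
    thus "exp (- b * real n ^ 2) \<le> exp (- b) ^ n"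
      by (simp add: mult_ac flip: exp_of_nat_mult)
  qed auto
  have "(\<lambda>j::int. exp (- b * (of_int j)^2)) summable_on range int"
    using nat_sum by (subst summable_on_reindex) (auto simp: o_def)
  moreover have "(\<lambda>j::int. exp (- b * (of_int j)^2)) summable_on range (\<lambda>n. - int n)"
    using nat_sum by (subst summable_on_reindex) (auto simp: o_def inj_on_def)
  ultimately have "(\<lambda>j::int. exp (- b * (of_int j)^2)) summable_on (range int \<union> range (\<lambda>n. - int n))"
    by (rule summable_on_union)
  moreover have "range int \<union> range (\<lambda>n. - int n) = UNIV"
  proof (intro equalityI subsetI)
    fix k :: int
    show "k \<in> range int \<union> range (\<lambda>n. - int n)"
      by (cases k rule: int_cases2) auto
  qed auto
  ultimately show ?thesis by simp
qed

text \<open>The point is uniformity in \<open>t\<close>: a shift by the floor of \<open>t\<close>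
  leaves an offset \<open>d\<close> in [0, 1], and halving the exponent absorbs that offset.\<close>

lemma shifted_gaussian_sum:
  fixes a t :: real
  assumes "a > 0"
  defines "S \<equiv> (\<Sum>\<^sub>\<infinity>j::int. exp (- (a / 2) * (of_int j)^2))"
  shows "(\<lambda>k::int. exp (- a * (t - of_int k)^2)) summable_on UNIV"
    and "(\<Sum>\<^sub>\<infinity>k::int. exp (- a * (t - of_int k)^2)) \<le> exp a * S"
proof -
  define f where "f k = exp (- a * (t - of_int k)^2)" for k :: int
  have summ: "(\<lambda>j::int. exp a * exp (- (a / 2) * (of_int j)^2)) summable_on UNIV"
    using assms by (intro summable_on_cmult_right summable_on_int_gaussian) auto
  have le: "f (\<lfloor>t\<rfloor> + j) \<le> exp a * exp (- (a / 2) * (of_int j)^2)" for j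
  proof -
    define d where "d = t - of_int \<lfloor>t\<rfloor>"
    have d: "0 \<le> d" "d \<le> 1"
      unfolding d_def by linarith+
    have "d^2 \<le> 1"
      using d by (simp add: power_le_one)
    \<comment> \<open>Half of this square is the excess of \<open>(d - j)^2\<close> over
      \<open>j^2 / 2 - d^2\<close>.\<close>
    moreover have "0 \<le> (real_of_int j - 2 * d)^2"
      by simp
    ultimately have "(of_int j)^2 / 2 - 1 \<le> (d - of_int j)^2"
      by (simp add: power2_eq_square algebra_simps)
    hence "a * ((of_int j)^2 / 2 - 1) \<le> a * (d - of_int j)^2"
      using assms by (intro mult_left_mono) auto
    thus ?thesis
      by (simp add: f_def d_def algebra_simps flip: exp_add)
  qed
  have bij: "bij_betw (\<lambda>j. \<lfloor>t\<rfloor> + j) UNIV UNIV"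
    by (rule bij_betwI[of _ _ _ "\<lambda>j. j - \<lfloor>t\<rfloor>"]) auto
  have shifted: "(\<lambda>j. f (\<lfloor>t\<rfloor> + j)) summable_on UNIV"
    using le by (intro summable_on_comparison_test[OF summ]) (auto simp: f_def)
  thus "(\<lambda>k::int. exp (- a * (t - of_int k)^2)) summable_on UNIV"
    unfolding summable_on_reindex_bij_betw[OF bij, of f] by (simp add: f_def[abs_def])
  have "infsum f UNIV = (\<Sum>\<^sub>\<infinity>j. f (\<lfloor>t\<rfloor> + j))"
    using infsum_reindex_bij_betw[OF bij, of f] by simp
  also have "\<dots> \<le> (\<Sum>\<^sub>\<infinity>j::int. exp a * exp (- (a / 2) * (of_int j)^2))"
    using le by (intro infsum_mono shifted summ)
  also have "\<dots> = exp a * S"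
    unfolding S_def by (rule infsum_cmult_right')
  finally show "(\<Sum>\<^sub>\<infinity>k::int. exp (- a * (t - of_int k)^2)) \<le> exp a * S"
    by (simp add: f_def[abs_def])
qed

definition gauss_laurent :: "real \<Rightarrow> (int \<Rightarrow> complex) \<Rightarrow> complex \<Rightarrow> complex" where
  "gauss_laurent a c w = (\<Sum>\<^sub>\<infinity>k. c k * of_real (exp (- a * (of_int k)^2)) * w powi k)"

text \<open>Expanding the square in \<open>- a * (x - k)^2\<close> leaves a cross term
  \<open>2 * a * k * x\<close>, which is a \<open>k\<close>-th power of
  \<open>exp (2 * a * x)\<close>.\<close>

lemma gauss_sum_eq_laurent:
  "gauss_sum a c x = of_real (exp (- a * x^2)) * gauss_laurent a c (of_real (exp (2 * a * x)))"
proof -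
  have "c k * of_real (exp (- a * (x - of_int k)^2)) =
     of_real (exp (- a * x^2)) * (c k * of_real (exp (- a * (of_int k)^2)) * of_real (exp (2 * a * x)) powi k)"
    for k
  proof -
    have "- a * (x - of_int k)^2 = - a * x^2 + - a * (of_int k)^2 + of_int k * (2 * a * x)"
      by (simp add: power2_eq_square algebra_simps)
    hence "exp (- a * (x - of_int k)^2) = exp (- a * x^2) * exp (- a * (of_int k)^2) * exp (2 * a * x) powi k"
      by (simp only: exp_add exp_power_int)
    thus ?thesis
      by (simp add: mult_ac)
  qed
  thus ?thesis
    unfolding gauss_sum_def gauss_laurent_def by (simp only: infsum_cmult_right')
qed

context
  fixes a :: real and c :: "int \<Rightarrow> complex" and B :: real
  assumes a: "a > 0" and c: "\<And>k. norm (c k) \<le> B"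
begin

text \<open>Completing the square in \<open>k\<close> isolates the growth factor and leaves a
  Gaussian centred at \<open>u / (2 * a)\<close>, where \<open>u = ln (norm w)\<close>. Its sum over
  \<open>k\<close> is bounded independently of \<open>u\<close>.\<close>

lemma norm_gauss_laurent_term_le:
  assumes "w \<noteq> 0"
  shows "norm (c k * of_real (exp (- a * (of_int k)^2)) * w powi k)
    \<le> B * exp ((ln (norm w))^2 / (4 * a)) * exp (- a * (ln (norm w) / (2 * a) - of_int k)^2)"
proof -
  define u where "u = ln (norm w)"
  have w: "norm w = exp u"
    using assms by (simp add: u_def)
  have "norm (c k * of_real (exp (- a * (of_int k)^2)) * w powi k)
      = norm (c k) * (exp (- a * (of_int k)^2) * exp (of_int k * u))"
    by (simp add: norm_mult norm_power_int w exp_power_int)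
  also have "\<dots> \<le> B * (exp (- a * (of_int k)^2) * exp (of_int k * u))"
    using c by (intro mult_right_mono) auto
  also have "- a * (of_int k)^2 + of_int k * u = u^2 / (4 * a) + - a * (u / (2 * a) - of_int k)^2"
    using a by (simp add: power2_eq_square field_simps)
  hence "exp (- a * (of_int k)^2) * exp (of_int k * u) = exp (u^2 / (4 * a)) * exp (- a * (u / (2 * a) - of_int k)^2)"
    by (simp only: flip: exp_add)
  finally show ?thesis
    by (simp add: u_def mult.assoc)
qed

lemma gauss_laurent_abs_summable:
  assumes "w \<noteq> 0"
  shows "(\<lambda>k. norm (c k * of_real (exp (- a * (of_int k)^2)) * w powi k)) summable_on UNIV"
  by (rule summable_on_comparison_test[OF summable_on_cmult_right[OF shifted_gaussian_sum(1)[OF a]]])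
     (use norm_gauss_laurent_term_le[OF assms] in auto)

lemma norm_gauss_laurent_le:
  assumes "w \<noteq> 0"
  shows "norm (gauss_laurent a c w) \<le>
    B * exp a * (\<Sum>\<^sub>\<infinity>j::int. exp (- (a / 2) * (of_int j)^2)) * exp ((ln (norm w))^2 / (4 * a))"
proof -
  let ?u = "ln (norm w)"
  have "B \<ge> 0"
    using c[of 0] norm_ge_zero order_trans by blast
  have "norm (gauss_laurent a c w) \<le>
      (\<Sum>\<^sub>\<infinity>k. norm (c k * of_real (exp (- a * (of_int k)^2)) * w powi k))"
    unfolding gauss_laurent_def by (rule norm_infsum_bound) (rule gauss_laurent_abs_summable[OF assms])
  also have "\<dots> \<le> (\<Sum>\<^sub>\<infinity>k::int. B * exp (?u^2 / (4 * a)) * exp (- a * (?u / (2 * a) - of_int k)^2))"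
    by (intro infsum_mono gauss_laurent_abs_summable summable_on_cmult_right shifted_gaussian_sum
          norm_gauss_laurent_term_le assms a)
  also have "\<dots> = B * exp (?u^2 / (4 * a)) * (\<Sum>\<^sub>\<infinity>k::int. exp (- a * (?u / (2 * a) - of_int k)^2))"
    by (rule infsum_cmult_right')
  also have "\<dots> \<le> B * exp (?u^2 / (4 * a)) * (exp a * (\<Sum>\<^sub>\<infinity>j::int. exp (- (a / 2) * (of_int j)^2)))"
    using \<open>B \<ge> 0\<close> by (intro mult_left_mono shifted_gaussian_sum a) auto
  finally show ?thesis
    by (simp add: mult_ac)
qed

text \<open>The nonnegative powers form an entire series in \<open>w\<close>, and the negative ones
  form \<open>inverse w\<close> times an entire series in \<open>inverse w\<close>.\<close>

lemma holomorphic_gauss_laurent: "gauss_laurent a c holomorphic_on - {0}"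
proof -
  define \<phi> where "\<phi> w k = c k * of_real (exp (- a * (of_int k)^2)) * w powi k" for w k
  define \<alpha> where "\<alpha> n = c (int n) * of_real (exp (- a * (of_nat n)^2))" for n
  \<comment> \<open>The index \<open>- 1 - n\<close> starts at -1, so the constant term is not
    counted in both halves.\<close>
  define \<beta> where "\<beta> n = c (- 1 - int n) * of_real (exp (- a * (of_nat n + 1)^2))" for n
  have summ: "(\<lambda>k. norm (\<phi> w k)) summable_on X" if "w \<noteq> 0" for w X
    using gauss_laurent_abs_summable[OF that] unfolding \<phi>_def
    by (rule summable_on_subset_banach) auto
  have reidx_pos: "\<phi> w \<circ> int = (\<lambda>n. \<alpha> n * w ^ n)" for w
    by (auto simp: \<phi>_def \<alpha>_def fun_eq_iff)
  have reidx_neg: "\<phi> w \<circ> (\<lambda>n. - 1 - int n) = (\<lambda>n. inverse w * (\<beta> n * inverse w ^ n))"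
    if "w \<noteq> 0" for w
  proof
    fix n
    have "- 1 - int n = - int (Suc n)" by simp
    hence "w powi (- 1 - int n) = inverse w * inverse w ^ n"
      by (simp only: power_int_minus power_int_of_nat) (simp add: power_inverse)
    moreover have "(- 1 - real n)^2 = (real n + 1)^2"
      by (simp add: power2_eq_square algebra_simps)
    ultimately show "(\<phi> w \<circ> (\<lambda>n. - 1 - int n)) n = inverse w * (\<beta> n * inverse w ^ n)"
      by (simp add: \<phi>_def \<beta>_def)
  qed
  have inj: "inj int" "inj (\<lambda>n. - 1 - int n)"
    by (auto simp: inj_on_def)
  have sums_pos: "(\<lambda>n. \<alpha> n * w ^ n) sums infsum (\<phi> w) (range int)" if "w \<noteq> 0" for w
  proof -
    have "(\<phi> w has_sum infsum (\<phi> w) (range int)) (range int)"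
      by (rule has_sum_infsum[OF abs_summable_summable[OF summ[OF that]]])
    hence "((\<lambda>n. \<alpha> n * w ^ n) has_sum infsum (\<phi> w) (range int)) UNIV"
      by (subst (asm) has_sum_reindex[OF inj(1)]) (simp add: reidx_pos)
    thus ?thesis
      by (rule has_sum_imp_sums)
  qed
  have sums_neg: "(\<lambda>n. \<beta> n * inverse w ^ n) sums (w * infsum (\<phi> w) (range (\<lambda>n. - 1 - int n)))"
    if "w \<noteq> 0" for w
  proof -
    have "(\<phi> w has_sum infsum (\<phi> w) (range (\<lambda>n. - 1 - int n))) (range (\<lambda>n. - 1 - int n))"
      by (rule has_sum_infsum[OF abs_summable_summable[OF summ[OF that]]])
    hence "((\<lambda>n. inverse w * (\<beta> n * inverse w ^ n)) has_sum
             infsum (\<phi> w) (range (\<lambda>n. - 1 - int n))) UNIV"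
      by (subst (asm) has_sum_reindex[OF inj(2)]) (simp add: reidx_neg[OF that])
    hence "(\<lambda>n. w * (inverse w * (\<beta> n * inverse w ^ n))) sums
             (w * infsum (\<phi> w) (range (\<lambda>n. - 1 - int n)))"
      by (intro sums_mult has_sum_imp_sums)
    thus ?thesis
      using that by (simp add: mult.assoc[symmetric])
  qed
  have entire: "(\<lambda>w. \<Sum>n. \<gamma> n * w ^ n) holomorphic_on UNIV"
    if "\<And>w. w \<noteq> 0 \<Longrightarrow> summable (\<lambda>n. \<gamma> n * w ^ n)" for \<gamma> :: "nat \<Rightarrow> complex"
  proof -
    have summable: "summable (\<lambda>n. \<gamma> n * w ^ n)" for w
      using that[of w] powser_sums_zero[of \<gamma>] by (cases "w = 0") (auto simp: sums_iff)
    have "(\<lambda>w. \<Sum>n. \<gamma> n * w ^ n) holomorphic_on ball 0 r" for r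
      using summable by (intro power_series_holomorphic) (auto intro: summable_sums)
    hence "(\<lambda>w. \<Sum>n. \<gamma> n * w ^ n) holomorphic_on (\<Union>r. ball 0 r)"
      by (intro holomorphic_on_UN_open) auto
    moreover have "(\<Union>r. ball (0::complex) r) = UNIV"
      by (auto intro: gt_ex)
    ultimately show ?thesis by simp
  qed
  have \<alpha>: "(\<lambda>w. \<Sum>n. \<alpha> n * w ^ n) holomorphic_on UNIV"
    by (rule entire) (rule sums_summable[OF sums_pos])
  have \<beta>: "(\<lambda>w. \<Sum>n. \<beta> n * w ^ n) holomorphic_on UNIV"
  proof (rule entire)
    fix w :: complex assume "w \<noteq> 0"
    thus "summable (\<lambda>n. \<beta> n * w ^ n)"
      using sums_summable[OF sums_neg[of "inverse w"]] by simp
  qed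
  have "(\<lambda>w. \<Sum>n. \<beta> n * w ^ n) \<circ> inverse holomorphic_on - {0}"
    by (rule holomorphic_on_compose_gen[OF _ \<beta>]) (auto intro!: holomorphic_intros)
  moreover have "(\<lambda>w. \<Sum>n. \<alpha> n * w ^ n) holomorphic_on - {0}"
    by (rule holomorphic_on_subset[OF \<alpha>]) auto
  moreover have "inverse holomorphic_on - {0::complex}"
    by (auto intro!: holomorphic_intros)
  ultimately have "(\<lambda>w. (\<Sum>n. \<alpha> n * w ^ n) +
      inverse w * ((\<lambda>w. \<Sum>n. \<beta> n * w ^ n) \<circ> inverse) w) holomorphic_on - {0}"
    by (rule holomorphic_on_add[OF _ holomorphic_on_mult, rotated -1])
  moreover have "gauss_laurent a c w =
      (\<Sum>n. \<alpha> n * w ^ n) + inverse w * ((\<lambda>w. \<Sum>n. \<beta> n * w ^ n) \<circ> inverse) w" if "w \<noteq> 0" for w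
  proof -
    have UNIV_int: "UNIV = range int \<union> range (\<lambda>n. - 1 - int n)"
    proof (intro equalityI subsetI)
      fix k :: int
      show "k \<in> range int \<union> range (\<lambda>n. - 1 - int n)"
      proof (cases "k \<ge> 0")
        case True
        hence "k = int (nat k)" by simp
        thus ?thesis by blast
      next
        case False
        hence "k = - 1 - int (nat (- 1 - k))" by simp
        thus ?thesis by blast
      qed
    qed auto
    have "gauss_laurent a c w = infsum (\<phi> w) UNIV"
      by (simp add: gauss_laurent_def \<phi>_def[abs_def])
    also have "\<dots> = infsum (\<phi> w) (range int) + infsum (\<phi> w) (range (\<lambda>n. - 1 - int n))"
      unfolding UNIV_int
      by (rule infsum_Un_disjoint) (auto intro!: abs_summable_summable[OF summ[OF that]])
    also have "infsum (\<phi> w) (range int) = (\<Sum>n. \<alpha> n * w ^ n)"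
      using sums_pos[OF that] by (simp add: sums_iff)
    also have "infsum (\<phi> w) (range (\<lambda>n. - 1 - int n)) = inverse w * (\<Sum>n. \<beta> n * inverse w ^ n)"
      using sums_neg[OF that] that by (simp add: sums_iff mult.assoc[symmetric])
    finally show ?thesis by simp
  qed
  ultimately show ?thesis
    by (subst holomorphic_cong[OF refl]) auto
qed

end

section \<open>Counting zeros in windows\<close>

text \<open>The Gaussian factor never vanishes, and the exponential substitution is locally
  injective because its derivative is nonzero. Neither changes the order of vanishing.\<close>

lemma zorder_exp_substitution:
  fixes F :: "complex \<Rightarrow> complex" and a x0 x :: real
  assumes F: "F holomorphic_on - {0}" "F 1 \<noteq> 0" and a: "a > 0"
  shows "zorder (\<lambda>z. exp (- of_real a * z^2) * F (exp (of_real (2 * a) * (z - of_real x0)))) (of_real x)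
    = zorder F (of_real (exp (2 * a * (x - x0))))"
proof -
  define g where "g z = exp (of_real (2 * a) * (z - of_real x0))" for z :: complex
  define E where "E z = exp (- of_real a * z^2)" for z :: complex
  let ?x = "of_real x :: complex"
  have conn: "connected (- {0::complex})"
    by (intro connected_punctured_universe) auto
  have gx: "g ?x = of_real (exp (2 * a * (x - x0)))"
    by (simp add: g_def exp_of_real[symmetric])
  have g_nz: "g z \<noteq> 0" for z
    by (simp add: g_def)
  have g_hol: "g holomorphic_on UNIV"
    unfolding g_def by (intro holomorphic_intros)
  have Fg_hol: "F \<circ> g holomorphic_on UNIV"
    using g_nz by (intro holomorphic_on_compose_gen[OF g_hol F(1)]) auto
  have g_deriv: "deriv g ?x = of_real (2 * a) * g ?x"
    unfolding g_def by (rule DERIV_imp_deriv) (auto intro!: derivative_eq_intros)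
  have g_order: "zorder (\<lambda>z. g z - g ?x) ?x = 1"
  proof (rule zorder_zero_eqI[of _ UNIV])
    have "deriv (\<lambda>z. g z - g ?x) ?x = deriv g ?x"
      by (subst deriv_diff) (use g_hol in \<open>auto simp: holomorphic_on_imp_differentiable_at\<close>)
    thus "(deriv ^^ nat 1) (\<lambda>z. g z - g ?x) ?x \<noteq> 0"
      using a g_nz g_deriv by simp
  qed (use g_hol in \<open>auto intro!: holomorphic_intros\<close>)
  have "eventually (\<lambda>z. g z - g ?x \<noteq> 0) (at ?x)"
  proof (rule eventually_nonzero_at[of _ UNIV])
    show "\<exists>w\<in>UNIV. g w - g ?x \<noteq> 0"
    proof (rule ccontr)
      assume "\<not> ?thesis"
      hence "g = (\<lambda>_. g ?x)" by auto
      hence "deriv g ?x = 0" by (metis deriv_const)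
      thus False
        using a g_nz g_deriv by simp
    qed
  qed (use g_hol in \<open>auto intro!: holomorphic_intros\<close>)
  hence g_ne: "eventually (\<lambda>z. g z \<noteq> g ?x) (at ?x)"
    by simp
  have F_ana: "F analytic_on {g ?x}"
    using F(1) g_nz analytic_at[of F "g ?x"] by (metis ComplI open_Compl closed_singleton singletonD)
  have F_ne: "eventually (\<lambda>w. F w \<noteq> 0) (at (g ?x))"
    using F g_nz conn by (intro eventually_nonzero_at[of _ "- {0}"]) (auto intro!: bexI[of _ 1])
  have "zorder (F \<circ> g) ?x = zorder F (g ?x) * zorder (\<lambda>z. g z - g ?x) ?x"
  proof (rule zorder_compose')
    show "isolated_singularity_at F (g ?x)" "not_essential F (g ?x)"
      using F_ana isolated_singularity_at_analytic not_essential_analytic by blast+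
    show "g analytic_on {?x}"
      using g_hol analytic_at by blast
  qed (fact F_ne g_ne)+
  hence Fg_order: "zorder (F \<circ> g) ?x = zorder F (g ?x)"
    by (simp add: g_order)
  have "eventually (\<lambda>z. (F \<circ> g) z \<noteq> 0) (at ?x)"
  proof (rule eventually_nonzero_at[OF Fg_hol])
    show "\<exists>w\<in>UNIV. (F \<circ> g) w \<noteq> 0"
      using F(2) by (intro bexI[of _ "of_real x0"]) (auto simp: g_def)
  qed auto
  hence ev: "eventually (\<lambda>z. E z * (F \<circ> g) z \<noteq> 0) (at ?x)"
    by eventually_elim (simp add: E_def)
  have E_ana: "E analytic_on {?x}"
    unfolding E_def by (intro analytic_intros)
  have "zorder (\<lambda>z. E z * (F \<circ> g) z) ?x = zorder E ?x + zorder (F \<circ> g) ?x"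
    using Fg_hol analytic_at by (intro zorder_times_analytic E_ana ev) blast
  also have "zorder E ?x = 0"
    by (rule zorder_eq_0I[OF E_ana]) (simp add: E_def)
  finally have "zorder (\<lambda>z. E z * F (g z)) ?x = zorder F (g ?x)"
    using Fg_order by (simp add: o_def)
  thus ?thesis
    unfolding gx by (simp only: E_def g_def)
qed

text \<open>In the variable \<open>ln (norm w)\<close> windows repeat with period
  \<open>L = 2 * a * l\<close>, and the growth coefficient is \<open>1 / (4 * a)\<close>. The bound
  \<open>2 * \<alpha> * L\<close> of \<open>zero_count_le_growth\<close> is therefore exactly
  \<open>l\<close>.\<close>

lemma window_count_le:
  fixes a r l :: real and c :: "int \<Rightarrow> complex" and n :: nat
  defines "f \<equiv> gauss_sum a c"
  assumes a: "a > 0" and c: "\<And>k. norm (c k) \<le> B" and nz: "f x0 \<noteq> 0"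
    and r: "0 < r" and l: "2 * r < l"
    and count: "\<And>x. n \<le> (\<Sum>t\<in>{x. f x = 0} \<inter> {x - r..x + r}. zero_mult f t)"
  shows "real n \<le> l"
proof -
  \<comment> \<open>Rescaling \<open>w\<close> moves the nonzero of \<open>f\<close> at
    \<open>x0\<close> to \<open>w = 1\<close>.\<close>
  define F where "F w = gauss_laurent a c (w * of_real (exp (2 * a * x0)))" for w
  define L where "L = 2 * a * l"
  have L: "L > 0"
    using a r l by (simp add: L_def)
  have F_hol: "F holomorphic_on - {0}"
  proof -
    have "gauss_laurent a c \<circ> (\<lambda>w. w * of_real (exp (2 * a * x0))) holomorphic_on - {0}"
      by (rule holomorphic_on_compose_gen[OF _ holomorphic_gauss_laurent[OF a c]])
         (auto intro!: holomorphic_intros)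
    thus ?thesis
      by (simp add: F_def[abs_def] o_def)
  qed
  have F1: "F 1 \<noteq> 0"
    using nz by (simp add: F_def f_def gauss_sum_eq_laurent)

  define g where "g z = exp (- of_real a * z^2) * F (exp (of_real (2 * a) * (z - of_real x0)))"
    for z :: complex
  have f_eq: "f x = g (of_real x)" for x
  proof -
    have "exp (of_real (2 * a) * (of_real x - of_real x0)) * of_real (exp (2 * a * x0))
        = (of_real (exp (2 * a * (x - x0)) * exp (2 * a * x0)) :: complex)"
      by (simp add: exp_of_real[symmetric])
    also have "\<dots> = of_real (exp (2 * a * x))"
      by (simp add: algebra_simps flip: exp_add)
    finally show ?thesis
      by (simp add: f_def g_def F_def gauss_sum_eq_laurent exp_of_real[symmetric])
  qed
  have g_hol: "g holomorphic_on UNIV"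
  proof -
    have "F \<circ> (\<lambda>z. exp (of_real (2 * a) * (z - of_real x0))) holomorphic_on UNIV"
      by (rule holomorphic_on_compose_gen[OF _ F_hol]) (auto intro!: holomorphic_intros)
    thus ?thesis
      unfolding g_def o_def by (intro holomorphic_intros)
  qed
  have mult: "int (zero_mult f x) = zorder F (of_real (exp (2 * a * (x - x0))))" for x
  proof -
    have "int (zero_mult (\<lambda>x. g (of_real x)) x) = zorder g (of_real x)"
      using nz by (intro zero_mult_eq_zorder[OF g_hol]) (auto simp: f_eq)
    also have "(\<lambda>x. g (of_real x)) = f"
      by (simp add: f_eq fun_eq_iff)
    also have "zorder g (of_real x) = zorder F (of_real (exp (2 * a * (x - x0))))"
      unfolding g_def by (rule zorder_exp_substitution[OF F_hol F1 a])
    finally show ?thesis .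
  qed

  \<comment> \<open>The window centred at \<open>x0 + j * l + r\<close> has its left end at the
    lattice point \<open>x0 + j * l\<close>.\<close>
  have "\<exists>z :: nat \<Rightarrow> real. (\<forall>i<n. z i \<in> {x0 + of_int j * l..x0 + of_int j * l + 2 * r}) \<and>
      (\<forall>s. card {i. i < n \<and> z i = s} \<le> zero_mult f s)" for j :: int
    using select_with_multiplicity[OF count[of "x0 + of_int j * l + r"]] by (auto simp: add_ac)
  then obtain z :: "int \<Rightarrow> nat \<Rightarrow> real" where
    z: "\<And>j i. i < n \<Longrightarrow> z j i \<in> {x0 + of_int j * l..x0 + of_int j * l + 2 * r}" and
    z_card: "\<And>j s. card {i. i < n \<and> z j i = s} \<le> zero_mult f s"
    by metis
  define P where "P j i = 2 * a * (z j i - x0)" for j i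

  have P: "P j i \<in> {of_int j * L..(of_int j + 1) * L}" if "i < n" for j i
  proof -
    have "of_int j * l \<le> z j i - x0" "z j i - x0 \<le> (of_int j + 1) * l"
      using z[OF that, of j] l by (auto simp: algebra_simps)
    hence "2 * a * (of_int j * l) \<le> P j i" "P j i \<le> 2 * a * ((of_int j + 1) * l)"
      unfolding P_def using a by (intro mult_left_mono; simp)+
    thus ?thesis
      by (simp add: L_def mult_ac)
  qed
  \<comment> \<open>Because \<open>2 * r < l\<close>, closed windows with different numbers are
    disjoint, so no zero can be selected from two of them and overspend its multiplicity.\<close>
  have window_unique: "j = j'" if "z j i = z j' i'" "i < n" "i' < n" for i i' j j'
  proof -
    have less: "of_int j * l < (of_int j' + 1) * l" if "z j i = z j' i'" "i < n" "i' < n" for j j' i i'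
    proof -
      have "x0 + of_int j * l \<le> z j i" "z j i \<le> x0 + of_int j' * l + 2 * r"
        using z[OF that(2), of j] z[OF that(3), of j'] that(1) by auto
      thus ?thesis
        using l by (simp add: algebra_simps)
    qed
    have "real_of_int j < of_int j' + 1" "real_of_int j' < of_int j + 1"
      using less[OF that] less[OF that(1)[symmetric] that(3,2)] r l by auto
    thus ?thesis by linarith
  qed

  have factor: "\<exists>H. H holomorphic_on - {0} \<and> (\<forall>w. w \<noteq> 0 \<longrightarrow>
      F w = H w * (\<Prod>k<J. \<Prod>i<n. (w - of_real (exp (P (int k) i))) *
        (w - of_real (exp (- (- P (- 1 - int k) i))))))" for J
  proof -
    define I where "I = {- int J..<int J} \<times> {..<n}"
    define e where "e = (\<lambda>(j, i). of_real (exp (P j i)) :: complex)"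
    have "\<exists>H. H holomorphic_on - {0} \<and> (\<forall>w\<in>- {0}. F w = H w * (\<Prod>q\<in>I. w - e q))"
    proof (rule holomorphic_factor_zeros)
      show "\<exists>w\<in>- {0}. F w \<noteq> 0"
        using F1 by (intro bexI[of _ 1]) auto
      show "connected (- {0::complex})"
        by (intro connected_punctured_universe) auto
    next
      fix s :: complex assume s: "s \<in> - {0}"
      show "int (card {q\<in>I. e q = s}) \<le> zorder F s"
      proof (cases "{q\<in>I. e q = s} = {}")
        case True
        have "frequently (\<lambda>w. F w \<noteq> 0) (at s)"
          by (intro eventually_frequently eventually_nonzero_at[OF F_hol])
             (use F1 s in \<open>auto intro!: connected_punctured_universe bexI[of _ 1]\<close>)
        hence "zorder F s \<ge> 0"
          using F_hol s by (intro zorder_ge_0) (auto simp: analytic_at intro!: exI[of _ "- {0}"])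
        thus ?thesis
          unfolding True by simp
      next
        \<comment> \<open>All indices with value \<open>s\<close> come from the single window
          \<open>j\<close>, where \<open>z_card\<close> controls the fibre.\<close>
        case False
        then obtain j i where ji: "i < n" "e (j, i) = s"
          by (auto simp: I_def)
        have same: "j' = j \<and> z j' i' = z j i" if "i' < n" "e (j', i') = s" for j' i'
        proof -
          have "z j' i' = z j i"
            using that ji a by (auto simp: e_def P_def)
          thus ?thesis
            using window_unique[of j' i' j i] that ji by auto
        qed
        have "{q\<in>I. e q = s} \<subseteq> Pair j ` {i'. i' < n \<and> z j i' = z j i}"
          using same by (fastforce simp: I_def)
        hence "card {q\<in>I. e q = s} \<le> card (Pair j ` {i'. i' < n \<and> z j i' = z j i})"
          by (intro card_mono) auto
        also have "\<dots> \<le> card {i'. i' < n \<and> z j i' = z j i}"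
          by (intro card_image_le) auto
        also have "\<dots> \<le> zero_mult f (z j i)"
          by (rule z_card)
        finally show ?thesis
          using mult[of "z j i"] ji(2) by (simp add: e_def P_def)
      qed
    qed (auto simp: I_def e_def F_hol)
    moreover have "(\<Prod>q\<in>I. w - e q) = (\<Prod>k<J. \<Prod>i<n. (w - of_real (exp (P (int k) i))) *
        (w - of_real (exp (- (- P (- 1 - int k) i)))))" for w
    proof -
      have "(\<Prod>q\<in>I. w - e q) = (\<Prod>j\<in>{- int J..<int J}. \<Prod>i<n. w - of_real (exp (P j i)))"
        unfolding I_def e_def by (simp add: prod.cartesian_product case_prod_unfold)
      thus ?thesis
        by (simp add: prod_symmetric_int prod.distrib)
    qed
    ultimately show ?thesis by auto
  qed

  \<comment> \<open>The maximum with 1 makes \<open>M\<close> positive, so that it can enter the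
    exponent as \<open>ln M\<close>.\<close>
  define M where "M = max 1 (B * exp a * (\<Sum>\<^sub>\<infinity>j::int. exp (- (a / 2) * (of_int j)^2)))"
  have growth: "norm (F w) \<le> exp (1 / (4 * a) * (ln (norm w))^2 + \<bar>x0\<bar> * \<bar>ln (norm w)\<bar> + (a * x0^2 + ln M))"
    if w: "w \<noteq> 0" for w
  proof -
    define u where "u = ln (norm w)"
    have "ln (norm (w * of_real (exp (2 * a * x0)))) = u + 2 * a * x0"
      using w by (simp add: norm_mult ln_mult u_def)
    hence "norm (F w) \<le> B * exp a * (\<Sum>\<^sub>\<infinity>j::int. exp (- (a / 2) * (of_int j)^2)) * exp ((u + 2 * a * x0)^2 / (4 * a))"
      using norm_gauss_laurent_le[OF a c, of "w * of_real (exp (2 * a * x0))"] w by (simp add: F_def)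
    also have "\<dots> \<le> M * exp ((u + 2 * a * x0)^2 / (4 * a))"
      unfolding M_def by (intro mult_right_mono) auto
    also have "\<dots> = exp ((u + 2 * a * x0)^2 / (4 * a) + ln M)"
      by (simp add: exp_add M_def)
    \<comment> \<open>Recentring at \<open>x0\<close> costs only a linear term in \<open>u\<close>;
      the quadratic coefficient is unchanged.\<close>
    also have "(u + 2 * a * x0)^2 / (4 * a) = 1 / (4 * a) * u^2 + x0 * u + a * x0^2"
      using a by (simp add: power2_eq_square field_simps)
    also have "exp (\<dots> + ln M) \<le> exp (1 / (4 * a) * u^2 + \<bar>x0\<bar> * \<bar>u\<bar> + (a * x0^2 + ln M))"
      using abs_ge_self[of "x0 * u"] by (simp add: abs_mult)
    finally show ?thesis
      by (simp add: u_def)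
  qed

  have "real n \<le> 2 * (1 / (4 * a)) * L"
  proof (rule zero_count_le_growth[OF L growth F1 _ _ factor])
    show "P (int k) i \<in> {real k * L..(real k + 1) * L}" if "i < n" for k i
      using P[OF that, of "int k"] by simp
    show "- P (- 1 - int k) i \<in> {real k * L..(real k + 1) * L}" if "i < n" for k i
      using P[OF that, of "- 1 - int k"] by (simp add: algebra_simps)
  qed
  thus ?thesis
    using a by (simp add: L_def)
qed

theorem theorem4p3:
  fixes a :: real and c :: "int \<Rightarrow> complex"
  assumes "a > 0"
    and "\<exists>B. \<forall>k. norm (c k) \<le> B"
    and "\<exists>x. gauss_sum a c x \<noteq> 0"
  shows "lower_density {x. gauss_sum a c x = 0} (zero_mult (gauss_sum a c)) \<le> 1"
proof (rule ccontr)
  define f where "f = gauss_sum a c"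
  define S where "S r x = (\<Sum>t\<in>{x. f x = 0} \<inter> {x - r..x + r}. zero_mult f t)" for r x
  assume "\<not> ?thesis"
  hence "1 < Liminf at_top (\<lambda>r::real. ereal (INF x. (1 / (2 * r)) * real (S r x)))"
    by (simp add: lower_density_def f_def S_def not_le)
  hence "eventually (\<lambda>r::real. 1 < ereal (INF x. (1 / (2 * r)) * real (S r x))) at_top"
    by (rule less_LiminfD)
  hence "eventually (\<lambda>r::real. 0 < r \<and> 1 < ereal (INF x. (1 / (2 * r)) * real (S r x))) at_top"
    using eventually_gt_at_top[of 0] by eventually_elim auto
  \<comment> \<open>One radius suffices: the infimum over all centres at this \<open>r\<close>
    already controls every window.\<close>
  then obtain r :: real where r: "0 < r" "1 < ereal (INF x. (1 / (2 * r)) * real (S r x))"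
    using eventually_happens trivial_limit_at_top_linorder by blast
  define y where "y = (INF x. (1 / (2 * r)) * real (S r x))"
  have "y > 1"
    using r by (simp add: y_def one_ereal_def)
  \<comment> \<open>Rounding up is harmless because the counts \<open>S r x\<close> are integers,
    and it still leaves \<open>n\<close> strictly above \<open>2 * r\<close>.\<close>
  define n where "n = nat \<lceil>2 * r * y\<rceil>"
  have "2 * r * 1 < 2 * r * y"
    using r \<open>y > 1\<close> by (intro mult_strict_left_mono) auto
  hence n: "2 * r < real n"
    unfolding n_def by linarith
  have count: "n \<le> S r x" for x
  proof -
    have "y \<le> (1 / (2 * r)) * real (S r x)"
      unfolding y_def using r by (intro cINF_lower) (auto intro!: bdd_belowI[of _ 0])
    hence "2 * r * y \<le> real (S r x)"
      using r by (simp add: field_simps)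
    thus ?thesis
      unfolding n_def by linarith
  qed
  obtain B where B: "\<And>k. norm (c k) \<le> B"
    using assms(2) by blast
  obtain x0 where x0: "gauss_sum a c x0 \<noteq> 0"
    using assms(3) by blast
  \<comment> \<open>The period is the midpoint of \<open>2 * r\<close> and \<open>n\<close>: longer
    than a window, yet smaller than the count.\<close>
  have "real n \<le> (2 * r + real n) / 2"
    using n count unfolding S_def f_def
    by (intro window_count_le[OF assms(1) B x0 r(1)]) auto
  thus False
    using n by simp
qed

end
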